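(* Suppose $0<p\le 2$ and let $\phi\in\Omega_p(\mathbb{R}^d)$ be represented as $$\phi(\xi)=\int_0^\infty e^{-t|\xi|^p}\,d\nu(t)\qquad(\xi\in\mathbb{R}^d)$$ for a probability measure $\nu$ on $[0,\infty)$. Let $\mu$ be the probability measure on $\mathbb{R}^d$ determined by $\widehat\mu=\phi$. (S1) For $0<\alpha<p<2$, $$\int_{\mathbb{R}^d}|v|^\alpha\,d\mu(v)=\frac{2^\alpha\,\Gamma\left(1-\frac\alpha p\right)\Gamma\left(\frac{\alpha+d}{2}\right)}{\Gamma\left(1-\frac\alpha2\right)\Gamma\left(\frac d2\right)}\int_0^\infty t^{\alpha/p}\,d\nu(t).$$ (S2) For $p=2$ and $\alpha\ge 0$, $$\int_{\mathbb{R}^d}|v|^\alpha\,d\mu(v)=\frac{2^\alpha\,\Gamma\left(\frac{\alpha+d}{2}\right)}{\Gamma\left(\frac d2\right)}\int_0^\infty t^{\alpha/p}\,d\nu(t).$$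
   Context: Let $d\ge1$ and let $|\cdot|$ denote the Euclidean norm on $\mathbb{R}^d$. For $0<p\le2$, the Schoenberg class $\Omega_p(\mathbb{R}^d)$ is the family of functions $\phi$ on $\mathbb{R}^d$ admitting the representation $\phi(\xi)=\int_0^\infty e^{-t|\xi|^p}d\nu(t)$ for some Borel probability measure $\nu$ on $[0,\infty)$; every such $\phi$ is a characteristic function. The Fourier transform of $\mu$ is $\widehat\mu(\xi)=\int_{\mathbb{R}^d}e^{-i\xi\cdot v}d\mu(v)$. Integrals of nonnegative functions are understood in $[0,\infty]$, integrals over $[0,\infty)$ include the point $0$, and $|v|^0=t^0=1$. *)

theory Defs
  imports "HOL-Probability.Probability"
begin

text \<open>
  Real powers of nonnegative reals with the convention $x^0 = 1$ also at $x = 0$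
  (the library has \<^term>\<open>(0::real) powr 0 = 0\<close>).
\<close>
definition rpow :: "real \<Rightarrow> real \<Rightarrow> real" where
  "rpow x a = (if a = 0 then 1 else x powr a)"

definition borel_prob_on :: "'a::topological_space set \<Rightarrow> 'a measure \<Rightarrow> bool" where
  "borel_prob_on S M \<longleftrightarrow> prob_space M \<and> sets M = sets (restrict_space borel S)"

definition fourier_measure :: "(real ^ 'd) measure \<Rightarrow> real ^ 'd \<Rightarrow> complex" where
  "fourier_measure \<mu> \<xi> = (LINT v|\<mu>. exp (- (\<i> * complex_of_real (\<xi> \<bullet> v))))"

definition schoenberg_rep :: "real \<Rightarrow> real measure \<Rightarrow> (real ^ 'd \<Rightarrow> complex) \<Rightarrow> bool" where
  "schoenberg_rep p \<nu> \<phi> \<longleftrightarrow>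
     (\<forall>\<xi>. \<phi> \<xi> = complex_of_real (LINT t|\<nu>. exp (- t * norm \<xi> powr p)))"

definition schoenberg_class :: "real \<Rightarrow> (real ^ 'd \<Rightarrow> complex) set" where
  "schoenberg_class p = {\<phi>. \<exists>\<nu>. borel_prob_on {0..} \<nu> \<and> schoenberg_rep p \<nu> \<phi>}"

end

theory Submission imports Defs
begin

text \<open>
  Let $G$ be a standard Gaussian vector in $\mathbb{R}^d$. Averaging $\widehat\mu(\sqrt s\,G)$ over $G$ in
  two ways links the law of $|v|$ under $\mu$ with the mixing measure $\nu$:
  \[ \int e^{-s|v|^2/2}\,d\mu(v) = E\,\phi(\sqrt s\,G)
       = E\int_0^\infty e^{-s^{p/2}\, t|G|^p}\,d\nu(t). \]
  So the Laplace transform of $X = |v|^2/2$ at $s$ is that of $Y = t|G|^p$ (with $t \sim \nu$ independent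
  of $G$) at $s^{p/2}$; this is \<open>laplace_square_via_schoenberg\<close>.

  Moments are now read off from Laplace transforms by integrating against $s^{-b-1}\,ds$.

  \<^item> For $p < 2$ and $b = \alpha/2 < p/2$, the formula
  $\int_0^\infty (1 - e^{-ys^q})\, s^{-b-1}\,ds = y^{b/q}\,\Gamma(1 - b/q)/b$ with $q = 1$ for $X$ and
  $q = p/2$ for $Y$ gives $\Gamma(1-\alpha/2)\,E X^{\alpha/2} = \Gamma(1-\alpha/p)\,E Y^{\alpha/p}$
  (\<open>low_moment_of_laplace_powr\<close>).

  \<^item> For $p = 2$ the Laplace transforms of $X$ and $Y$ coincide. Replacing $1 - e^{-sx}$ by
  $(1 - e^{-sx})^n$ with $n > b$ gives $x^b$ times a positive finite constant, while the expectation
  still involves only values of the Laplace transform; hence all moments of positive order of $X$ and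
  $Y$ coincide (\<open>moment_eq_of_laplace_eq\<close>).

  Finally $E Y^{\alpha/p} = E|G|^\alpha \int t^{\alpha/p}\,d\nu(t)$ by independence, and
  $E|G|^\alpha = 2^{\alpha/2}\,\Gamma((\alpha+d)/2)/\Gamma(d/2)$ follows from the same comparison
  principle, because $|G|^2/2$ and the Gamma distribution with shape $d/2$ share the Laplace transform
  $(1+s)^{-d/2}$ (\<open>gauss_vec_norm_moment\<close>). These identities hold in $[0,\infty]$, so
  infinite moments are covered.
\<close>

section \<open>Reproducing powers from exponentials\<close>

lemma nn_integral_powr_tail:
  fixes a b :: real
  assumes a: "0 < a" and b: "0 < b"
  shows "(\<integral>\<^sup>+s. ennreal (s powr (- b - 1)) * indicator {a..} s \<partial>lborel) = ennreal (a powr (- b) / b)"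
proof -
  have "(\<integral>\<^sup>+s. ennreal (s powr (- b - 1)) * indicator {a..} s \<partial>lborel)
      = ennreal (0 - (- (a powr (- b) / b)))"
  proof (rule nn_integral_FTC_atLeast[where F = "\<lambda>s. - (s powr (- b) / b)"])
    fix s assume "a \<le> s"
    then show "((\<lambda>s. - (s powr (- b) / b)) has_real_derivative s powr (- b - 1)) (at s)"
      using a b by (auto intro!: derivative_eq_intros simp: field_simps)
  next
    have "((\<lambda>s. s powr (- b)) \<longlongrightarrow> 0) at_top"
      using b by (intro tendsto_neg_powr filterlim_ident) auto
    then have "((\<lambda>s. - (s powr (- b) / b)) \<longlongrightarrow> - (0 / b)) at_top"
      using b by (intro tendsto_intros) auto
    then show "((\<lambda>s. - (s powr (- b) / b)) \<longlongrightarrow> 0) at_top" by simp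
  qed (auto)
  then show ?thesis by simp
qed

lemma nn_integral_exp_Icc:
  fixes z :: real
  assumes "0 \<le> z"
  shows "(\<integral>\<^sup>+u. ennreal (exp (- u)) * indicator {0..z} u \<partial>lborel) = ennreal (1 - exp (- z))"
proof -
  have "(\<integral>\<^sup>+u. ennreal (exp (- u)) * indicator {0..z} u \<partial>lborel)
      = ennreal (- exp (- z) - (- exp (- 0)))"
    using assms
    by (intro nn_integral_FTC_Icc[where F = "\<lambda>u. - exp (- u)"]) (auto intro!: derivative_eq_intros)
  then show ?thesis by simp
qed

text \<open>
  This reproduces a power of $y$ from exponentials, with an explicit constant. Writing
  $1 - e^{-z} = \int_0^z e^{-u}\,du$ with $z = y s^q$ and exchanging the integrals leaves, for each
  $u$, the tail integral of $s^{-b-1}$ over $s \ge (u/y)^{1/q}$, which is $(y/u)^{b/q}/b$; the remaining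
  integral over $u$ is the Gamma integral at $1 - b/q$. The exponent $q$ is carried along because
  $\phi(\sqrt s\,x)$ depends on $s$ through $s^{p/2}$.
\<close>
lemma nn_integral_one_minus_exp:
  fixes q b y :: real
  assumes b: "0 < b" and bq: "b < q" and y: "0 \<le> y"
  shows "(\<integral>\<^sup>+s. ennreal ((1 - exp (- (y * s powr q))) * s powr (- b - 1)) * indicator {0<..} s \<partial>lborel)
         = ennreal (Gamma (1 - b / q) / b) * ennreal (y powr (b / q))"
proof (cases "y = 0")
  case True
  then show ?thesis by simp
next
  case False
  with y have y: "0 < y" by simp
  have q: "0 < q" using b bq by simp
  have "(\<integral>\<^sup>+s. ennreal ((1 - exp (- (y * s powr q))) * s powr (- b - 1)) * indicator {0<..} s \<partial>lborel)
      = (\<integral>\<^sup>+s. (\<integral>\<^sup>+u. ennreal (exp (- u)) * (indicator {0..y * s powr q} u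
            * (ennreal (s powr (- b - 1)) * indicator {0<..} s)) \<partial>lborel) \<partial>lborel)"
  proof (intro nn_integral_cong)
    fix s :: real
    have "ennreal ((1 - exp (- (y * s powr q))) * s powr (- b - 1)) * indicator {0<..} s
        = (\<integral>\<^sup>+u. ennreal (exp (- u)) * indicator {0..y * s powr q} u \<partial>lborel)
            * (ennreal (s powr (- b - 1)) * indicator {0<..} s)"
      using y by (subst nn_integral_exp_Icc) (auto simp: ennreal_mult mult.assoc)
    also have "\<dots> = (\<integral>\<^sup>+u. ennreal (exp (- u)) * (indicator {0..y * s powr q} u
            * (ennreal (s powr (- b - 1)) * indicator {0<..} s)) \<partial>lborel)"
      by (subst nn_integral_multc[symmetric]) (auto simp: mult.assoc)
    finally show "ennreal ((1 - exp (- (y * s powr q))) * s powr (- b - 1)) * indicator {0<..} s = \<dots>" .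
  qed
  also have "\<dots> = (\<integral>\<^sup>+u. (\<integral>\<^sup>+s. ennreal (exp (- u)) * (indicator {0..y * s powr q} u
            * (ennreal (s powr (- b - 1)) * indicator {0<..} s)) \<partial>lborel) \<partial>lborel)"
  proof (rule lborel_pair.Fubini')
    have "(\<lambda>(u, s). ennreal (exp (- u)) * (indicator {v. 0 \<le> fst v \<and> fst v \<le> y * snd v powr q} (u, s)
            * (ennreal (s powr (- b - 1)) * indicator {0<..} s)))
         \<in> borel_measurable (lborel \<Otimes>\<^sub>M lborel :: (real \<times> real) measure)"
      by measurable
    then show "case_prod (\<lambda>u s. ennreal (exp (- u)) * (indicator {0..y * s powr q} u
            * (ennreal (s powr (- b - 1)) * indicator {0<..} s)))
         \<in> borel_measurable (lborel \<Otimes>\<^sub>M lborel)"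
      by (rule measurable_cong[THEN iffD1, rotated]) (auto simp: indicator_def)
  qed
  also have "\<dots> = (\<integral>\<^sup>+u. ennreal (y powr (b / q) / b)
            * ennreal (indicator {0..} u * u powr ((1 - b / q) - 1) / exp u) \<partial>lborel)"
  \<comment> \<open>At $u = 0$ the inner integral is infinite, so the integrands agree only almost everywhere.\<close>
  proof (rule nn_integral_cong_AE, use AE_lborel_singleton[of 0] in eventually_elim)
    fix u :: real assume u: "u \<noteq> 0"
    show "(\<integral>\<^sup>+s. ennreal (exp (- u)) * (indicator {0..y * s powr q} u
            * (ennreal (s powr (- b - 1)) * indicator {0<..} s)) \<partial>lborel)
        = ennreal (y powr (b / q) / b)
            * ennreal (indicator {0..} u * u powr ((1 - b / q) - 1) / exp u)"
    proof (cases "0 < u")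
      case False
      then show ?thesis using u by (simp add: indicator_def)
    next
      case True
      \<comment> \<open>The threshold in $s$ at which $y s^q$ reaches $u$.\<close>
      define a where "a = (u / y) powr (1 / q)"
      have a: "0 < a" using True y by (simp add: a_def)
      have aq: "a powr q = u / y" using q True y by (simp add: a_def powr_powr)
      have iff: "u \<le> y * s powr q \<longleftrightarrow> a \<le> s" if "0 < s" for s
      proof -
        have "u \<le> y * s powr q \<longleftrightarrow> a powr q \<le> s powr q"
          using y by (simp add: aq field_simps)
        also have "\<dots> \<longleftrightarrow> a \<le> s"
          using that a q by (metis powr_less_mono2 powr_mono2 less_le_not_le not_le less_imp_le)
        finally show ?thesis .
      qed
      have "(\<integral>\<^sup>+s. ennreal (exp (- u)) * (indicator {0..y * s powr q} u
            * (ennreal (s powr (- b - 1)) * indicator {0<..} s)) \<partial>lborel)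
          = (\<integral>\<^sup>+s. ennreal (exp (- u)) * (ennreal (s powr (- b - 1)) * indicator {a..} s) \<partial>lborel)"
        using True a iff by (intro nn_integral_cong) (auto simp: indicator_def)
      also have "\<dots> = ennreal (exp (- u)) * ennreal (a powr (- b) / b)"
        by (subst nn_integral_cmult) (auto simp: nn_integral_powr_tail[OF a b])
      also have "a powr (- b) = y powr (b / q) * u powr ((1 - b / q) - 1)"
        using True y q by (simp add: a_def powr_powr powr_divide powr_minus field_simps)
      finally show ?thesis
        using True y b
        by (simp add: ennreal_mult[symmetric] exp_minus field_simps)
    qed
  qed
  also have "\<dots> = ennreal (y powr (b / q) / b) * ennreal (Gamma (1 - b / q))"
    using b bq q by (subst nn_integral_cmult) (auto simp: Gamma_conv_nn_integral_real)
  finally show ?thesis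
    using b bq q by (simp add: ennreal_mult[symmetric] Gamma_real_pos mult_ac)
qed

text \<open>
  The total mass of the kernel that reproduces the power $x^b$ from $(1 - e^{-sx})^n$. Only its
  positivity and its finiteness (for $n > b$) matter: it cancels from both sides when two moments
  are compared, so it is never evaluated.
\<close>
definition kernel_const :: "nat \<Rightarrow> real \<Rightarrow> ennreal" where
  "kernel_const n b = (\<integral>\<^sup>+s. ennreal ((1 - exp (- s)) ^ n * s powr (- b - 1)) * indicator {0<..} s \<partial>lborel)"

lemma kernel_const_pos:
  assumes b: "0 < b"
  shows "0 < kernel_const n b"
proof -
  have "0 < ennreal ((1 - exp (- 1)) ^ n) * ennreal (1 powr (- b) / b)"
    using b by (simp add: ennreal_zero_less_mult_iff)
  also have "\<dots> = (\<integral>\<^sup>+s. ennreal ((1 - exp (- 1)) ^ n) * (ennreal (s powr (- b - 1)) * indicator {1..} s) \<partial>lborel)"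
    using b by (subst nn_integral_cmult) (auto simp: nn_integral_powr_tail)
  also have "\<dots> \<le> kernel_const n b"
    unfolding kernel_const_def
    by (intro nn_integral_mono)
       (auto simp: indicator_def ennreal_mult[symmetric] intro!: ennreal_leI mult_right_mono power_mono)
  finally show ?thesis .
qed

text \<open>
  The condition $b < n$ makes the integrand, which is of order $s^{n-b-1}$, integrable at $0$. On
  $(0,1)$ it is dominated by $e$ times the integrand of $\Gamma(n-b)$, and on $[1,\infty)$ by
  $s^{-b-1}$.
\<close>
lemma kernel_const_finite:
  assumes b: "0 < b" "b < real n"
  shows "kernel_const n b < \<infinity>"
proof -
  have "kernel_const n b \<le>
      (\<integral>\<^sup>+s. ennreal (exp 1) * ennreal (indicator {0..} s * s powr ((real n - b) - 1) / exp s)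
            + ennreal (s powr (- b - 1)) * indicator {1..} s \<partial>lborel)"
    unfolding kernel_const_def
  proof (rule nn_integral_mono)
    fix s :: real
    show "ennreal ((1 - exp (- s)) ^ n * s powr (- b - 1)) * indicator {0<..} s
      \<le> ennreal (exp 1) * ennreal (indicator {0..} s * s powr ((real n - b) - 1) / exp s)
            + ennreal (s powr (- b - 1)) * indicator {1..} s"
    proof (cases "0 < s")
      case False
      then show ?thesis by simp
    next
      case s: True
      show ?thesis
      proof (cases "1 \<le> s")
        case True
        have "(1 - exp (- s)) ^ n \<le> 1 ^ n"
          using s by (intro power_mono) auto
        then have "(1 - exp (- s)) ^ n * s powr (- b - 1) \<le> 1 * s powr (- b - 1)"
          by (intro mult_right_mono) auto
        then show ?thesis
          using True s by (intro add_increasing) (auto intro!: ennreal_leI)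
      next
        case False
        have "1 - exp (- s) \<le> s" using exp_ge_add_one_self[of "- s"] by simp
        then have "(1 - exp (- s)) ^ n \<le> s ^ n"
          using s by (intro power_mono) auto
        then have "(1 - exp (- s)) ^ n * s powr (- b - 1) \<le> s ^ n * s powr (- b - 1)"
          by (intro mult_right_mono) auto
        also have "\<dots> = 1 * s powr ((real n - b) - 1)"
          using s by (simp add: powr_realpow[symmetric] powr_add[symmetric] algebra_simps)
        also have "\<dots> \<le> exp (1 - s) * s powr ((real n - b) - 1)"
          using False by (intro mult_right_mono) auto
        also have "\<dots> = exp 1 * (s powr ((real n - b) - 1) / exp s)"
          by (simp add: exp_diff)
        finally show ?thesis
          using False s by (auto simp: ennreal_mult[symmetric] intro!: ennreal_leI)
      qed
    qed
  qed
  also have "\<dots> = ennreal (exp 1) * ennreal (Gamma (real n - b)) + ennreal (1 powr (- b) / b)"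
    using b by (subst nn_integral_add)
      (auto simp: nn_integral_cmult nn_integral_powr_tail Gamma_conv_nn_integral_real)
  also have "\<dots> < \<infinity>" by (simp add: ennreal_mult_less_top)
  finally show ?thesis .
qed

lemma kernel_scaling:
  assumes b: "0 < b" and n: "0 < n" and x: "0 \<le> x"
  shows "(\<integral>\<^sup>+s. ennreal ((1 - exp (- (s * x))) ^ n * s powr (- b - 1)) * indicator {0<..} s \<partial>lborel)
         = kernel_const n b * ennreal (x powr b)"
proof (cases "x = 0")
  case True
  then show ?thesis using n by (simp add: zero_power)
next
  case False
  with x have x: "0 < x" by simp
  have "(\<integral>\<^sup>+s. ennreal ((1 - exp (- (s * x))) ^ n * s powr (- b - 1)) * indicator {0<..} s \<partial>lborel)
      = ennreal (1 / x) * (\<integral>\<^sup>+s. ennreal ((1 - exp (- s)) ^ n * (s / x) powr (- b - 1)) * indicator {0<..} s \<partial>lborel)"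
    using x by (subst nn_integral_real_affine[where c = "1 / x" and t = 0])
      (auto simp: indicator_def zero_less_divide_iff intro!: arg_cong2[where f="(*)"] nn_integral_cong)
  also have "\<dots> = ennreal (1 / x) * (\<integral>\<^sup>+s. ennreal (x powr (b + 1)) *
        (ennreal ((1 - exp (- s)) ^ n * s powr (- b - 1)) * indicator {0<..} s) \<partial>lborel)"
  proof (rule arg_cong[where f = "(*) (ennreal (1 / x))"], rule nn_integral_cong)
    fix s :: real
    have "(s / x) powr (- b - 1) = x powr (b + 1) * s powr (- b - 1)" if "0 < s"
      using x that powr_minus_divide[of x "b + 1"] by (simp add: powr_divide)
    then show "ennreal ((1 - exp (- s)) ^ n * (s / x) powr (- b - 1)) * indicator {0<..} s
      = ennreal (x powr (b + 1)) * (ennreal ((1 - exp (- s)) ^ n * s powr (- b - 1)) * indicator {0<..} s)"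
      by (auto simp: indicator_def ennreal_mult[symmetric] mult_ac)
  qed
  also have "\<dots> = ennreal (1 / x) * (ennreal (x powr (b + 1)) * kernel_const n b)"
    by (subst nn_integral_cmult) (auto simp: kernel_const_def)
  also have "\<dots> = kernel_const n b * ennreal (1 / x * x powr (b + 1))"
    using x by (subst ennreal_mult) (auto simp: mult_ac)
  also have "1 / x * x powr (b + 1) = x powr b"
    using x by (simp add: powr_add)
  finally show ?thesis .
qed

section \<open>Moments from Laplace transforms\<close>

text \<open>
  Integrate the scaling identity for $(1 - e^{-sx})^n$ over $x = X$ and expand the power
  binomially: only values of the Laplace transform of $X$ remain. Using a power of
  $1 - e^{-sx}$ in place of a Taylor remainder of $e^{-sx}$ reaches arbitrarily high $b$ without
  presupposing that lower moments are finite.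
\<close>
lemma moment_via_laplace:
  fixes X :: "'a \<Rightarrow> real"
  assumes "prob_space M" and X[measurable]: "X \<in> borel_measurable M"
    and nonneg: "\<And>w. w \<in> space M \<Longrightarrow> 0 \<le> X w"
    and b: "0 < b" and n: "0 < n"
  shows "kernel_const n b * (\<integral>\<^sup>+w. ennreal (X w powr b) \<partial>M)
      = (\<integral>\<^sup>+s. ennreal ((\<Sum>k\<le>n. real (n choose k) * (- 1) ^ k * (\<integral>w. exp (- (real k * s * X w)) \<partial>M))
            * s powr (- b - 1)) * indicator {0<..} s \<partial>lborel)"
proof -
  interpret prob_space M by fact
  interpret P: pair_sigma_finite lborel M ..
  have "kernel_const n b * (\<integral>\<^sup>+w. ennreal (X w powr b) \<partial>M)
      = (\<integral>\<^sup>+w. (\<integral>\<^sup>+s. ennreal ((1 - exp (- (s * X w))) ^ n * s powr (- b - 1)) * indicator {0<..} s \<partial>lborel) \<partial>M)"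
    using nonneg by (subst nn_integral_cmult[symmetric])
      (auto simp: kernel_scaling[OF b n] intro!: nn_integral_cong)
  also have "\<dots> = (\<integral>\<^sup>+s. (\<integral>\<^sup>+w. ennreal ((1 - exp (- (s * X w))) ^ n * s powr (- b - 1)) * indicator {0<..} s \<partial>M) \<partial>lborel)"
    by (rule P.Fubini') measurable
  also have "\<dots> = (\<integral>\<^sup>+s. ennreal ((\<Sum>k\<le>n. real (n choose k) * (- 1) ^ k * (\<integral>w. exp (- (real k * s * X w)) \<partial>M))
            * s powr (- b - 1)) * indicator {0<..} s \<partial>lborel)"
  proof (rule nn_integral_cong)
    fix s :: real
    show "(\<integral>\<^sup>+w. ennreal ((1 - exp (- (s * X w))) ^ n * s powr (- b - 1)) * indicator {0<..} s \<partial>M)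
      = ennreal ((\<Sum>k\<le>n. real (n choose k) * (- 1) ^ k * (\<integral>w. exp (- (real k * s * X w)) \<partial>M))
            * s powr (- b - 1)) * indicator {0<..} s"
    proof (cases "0 < s")
      case False
      then show ?thesis by simp
    next
      case s: True
      have int[simp]: "integrable M (\<lambda>w. exp (- (real k * s * X w)))" for k
        using s nonneg by (intro integrable_const_bound[of _ 1]) auto
      have expand: "(1 - exp (- (s * X w))) ^ n
          = (\<Sum>k\<le>n. real (n choose k) * (- 1) ^ k * exp (- (real k * s * X w)))" for w
      proof -
        have "(- exp (- (s * X w))) ^ k = (- 1) ^ k * exp (- (real k * s * X w))" for k
          by (subst power_minus) (simp add: exp_of_nat_mult[symmetric] mult_ac)
        then show ?thesis
          using binomial_ring[of "- exp (- (s * X w))" 1 n] by (simp add: mult.assoc)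
      qed
      have "(\<integral>\<^sup>+w. ennreal ((1 - exp (- (s * X w))) ^ n * s powr (- b - 1)) \<partial>M)
          = ennreal (\<integral>w. (1 - exp (- (s * X w))) ^ n * s powr (- b - 1) \<partial>M)"
      proof (rule nn_integral_eq_integral)
        show "integrable M (\<lambda>w. (1 - exp (- (s * X w))) ^ n * s powr (- b - 1))"
          by (simp add: expand)
        show "AE w in M. 0 \<le> (1 - exp (- (s * X w))) ^ n * s powr (- b - 1)"
          using s nonneg by (intro AE_I2) simp
      qed
      also have "(\<integral>w. (1 - exp (- (s * X w))) ^ n * s powr (- b - 1) \<partial>M)
          = (\<Sum>k\<le>n. real (n choose k) * (- 1) ^ k * (\<integral>w. exp (- (real k * s * X w)) \<partial>M)) * s powr (- b - 1)"
        by (simp add: expand)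
      finally show ?thesis using s by simp
    qed
  qed
  finally show ?thesis .
qed

text \<open>
  The reproducing identity writes both moments, up to the same positive finite constant, as the same
  integral of Laplace transform values; this holds in $[0,\infty]$, so one moment is infinite if and
  only if the other is.
\<close>
lemma moment_eq_of_laplace_eq:
  fixes X :: "'a \<Rightarrow> real" and Y :: "'b \<Rightarrow> real"
  assumes M: "prob_space M" "X \<in> borel_measurable M" "\<And>w. w \<in> space M \<Longrightarrow> 0 \<le> X w"
    and N: "prob_space N" "Y \<in> borel_measurable N" "\<And>w. w \<in> space N \<Longrightarrow> 0 \<le> Y w"
    and laplace: "\<And>s. 0 < s \<Longrightarrow> (\<integral>w. exp (- (s * X w)) \<partial>M) = (\<integral>w. exp (- (s * Y w)) \<partial>N)"
    and b: "0 < b"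
  shows "(\<integral>\<^sup>+w. ennreal (X w powr b) \<partial>M) = (\<integral>\<^sup>+w. ennreal (Y w powr b) \<partial>N)"
proof -
  obtain n where n: "b < real n" using reals_Archimedean2 by blast
  with b have n0: "0 < n" by (cases n) auto
  have "(\<integral>w. exp (- (real k * s * X w)) \<partial>M) = (\<integral>w. exp (- (real k * s * Y w)) \<partial>N)" if "0 < s" for k s
    using laplace[of "real k * s"] that M(1) N(1)
    by (cases "k = 0") (auto simp: prob_space.prob_space)
  then have "(\<Sum>k\<le>n. real (n choose k) * (- 1) ^ k * (\<integral>w. exp (- (real k * s * X w)) \<partial>M))
      = (\<Sum>k\<le>n. real (n choose k) * (- 1) ^ k * (\<integral>w. exp (- (real k * s * Y w)) \<partial>N))" if "0 < s" for s
    using that by simp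
  then have "kernel_const n b * (\<integral>\<^sup>+w. ennreal (X w powr b) \<partial>M)
      = kernel_const n b * (\<integral>\<^sup>+w. ennreal (Y w powr b) \<partial>N)"
    using moment_via_laplace[OF M b n0] moment_via_laplace[OF N b n0]
    by (auto intro!: nn_integral_cong split: split_indicator)
  then show ?thesis
    using kernel_const_pos[OF b, of n] kernel_const_finite[OF b n] by (auto simp: ennreal_mult_cancel_left)
qed

lemma low_moment_via_laplace:
  fixes Y :: "'a \<Rightarrow> real"
  assumes "prob_space M" and Y[measurable]: "Y \<in> borel_measurable M"
    and nonneg: "\<And>w. w \<in> space M \<Longrightarrow> 0 \<le> Y w"
    and b: "0 < b" and bq: "b < q"
  shows "ennreal (Gamma (1 - b / q) / b) * (\<integral>\<^sup>+w. ennreal (Y w powr (b / q)) \<partial>M)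
      = (\<integral>\<^sup>+s. ennreal ((1 - (\<integral>w. exp (- (s powr q * Y w)) \<partial>M)) * s powr (- b - 1)) * indicator {0<..} s \<partial>lborel)"
proof -
  interpret prob_space M by fact
  interpret P: pair_sigma_finite lborel M ..
  have "ennreal (Gamma (1 - b / q) / b) * (\<integral>\<^sup>+w. ennreal (Y w powr (b / q)) \<partial>M)
      = (\<integral>\<^sup>+w. (\<integral>\<^sup>+s. ennreal ((1 - exp (- (Y w * s powr q))) * s powr (- b - 1)) * indicator {0<..} s \<partial>lborel) \<partial>M)"
    using nonneg by (subst nn_integral_cmult[symmetric])
      (auto simp: nn_integral_one_minus_exp[OF b bq] intro!: nn_integral_cong)
  also have "\<dots> = (\<integral>\<^sup>+s. (\<integral>\<^sup>+w. ennreal ((1 - exp (- (Y w * s powr q))) * s powr (- b - 1)) * indicator {0<..} s \<partial>M) \<partial>lborel)"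
    by (rule P.Fubini') measurable
  also have "\<dots> = (\<integral>\<^sup>+s. ennreal ((1 - (\<integral>w. exp (- (s powr q * Y w)) \<partial>M)) * s powr (- b - 1)) * indicator {0<..} s \<partial>lborel)"
  proof (rule nn_integral_cong)
    fix s :: real
    have int[simp]: "integrable M (\<lambda>w. exp (- (s powr q * Y w)))"
      using nonneg by (intro integrable_const_bound[of _ 1]) auto
    have "(\<integral>\<^sup>+w. ennreal ((1 - exp (- (s powr q * Y w))) * s powr (- b - 1)) \<partial>M)
        = ennreal (\<integral>w. (1 - exp (- (s powr q * Y w))) * s powr (- b - 1) \<partial>M)"
      using nonneg by (intro nn_integral_eq_integral AE_I2) auto
    also have "(\<integral>w. (1 - exp (- (s powr q * Y w))) * s powr (- b - 1) \<partial>M)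
        = (1 - (\<integral>w. exp (- (s powr q * Y w)) \<partial>M)) * s powr (- b - 1)"
      by (simp add: prob_space)
    finally show "(\<integral>\<^sup>+w. ennreal ((1 - exp (- (Y w * s powr q))) * s powr (- b - 1)) * indicator {0<..} s \<partial>M)
      = ennreal ((1 - (\<integral>w. exp (- (s powr q * Y w)) \<partial>M)) * s powr (- b - 1)) * indicator {0<..} s"
      by (simp add: mult.commute[of "Y _"] split: split_indicator)
  qed
  finally show ?thesis .
qed

text \<open>
  If the Laplace transform of $X$ at $s$ is that of $Y$ at $s^q$, then integrating
  $1 - E\,e^{-sX}$ against $s^{-b-1}$ yields the moment of order $b$ of $X$ from the left-hand side and
  that of order $b/q$ of $Y$ from the right-hand side. The two Gamma factors come from the two values $1$
  and $q$ of the exponent in the reproducing formula.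
\<close>
lemma low_moment_of_laplace_powr:
  fixes X :: "'a \<Rightarrow> real" and Y :: "'b \<Rightarrow> real"
  assumes M: "prob_space M" "X \<in> borel_measurable M" "\<And>w. w \<in> space M \<Longrightarrow> 0 \<le> X w"
    and N: "prob_space N" "Y \<in> borel_measurable N" "\<And>w. w \<in> space N \<Longrightarrow> 0 \<le> Y w"
    and laplace: "\<And>s. 0 < s \<Longrightarrow> (\<integral>w. exp (- (s * X w)) \<partial>M) = (\<integral>w. exp (- (s powr q * Y w)) \<partial>N)"
    and b: "0 < b" "b < 1" "b < q"
  shows "ennreal (Gamma (1 - b)) * (\<integral>\<^sup>+w. ennreal (X w powr b) \<partial>M)
       = ennreal (Gamma (1 - b / q)) * (\<integral>\<^sup>+w. ennreal (Y w powr (b / q)) \<partial>N)"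
proof -
  have "ennreal (Gamma (1 - b / 1) / b) * (\<integral>\<^sup>+w. ennreal (X w powr (b / 1)) \<partial>M)
      = (\<integral>\<^sup>+s. ennreal ((1 - (\<integral>w. exp (- (s powr 1 * X w)) \<partial>M)) * s powr (- b - 1)) * indicator {0<..} s \<partial>lborel)"
    using M b(1,2) by (rule low_moment_via_laplace)
  also have "\<dots> = (\<integral>\<^sup>+s. ennreal ((1 - (\<integral>w. exp (- (s powr q * Y w)) \<partial>N)) * s powr (- b - 1)) * indicator {0<..} s \<partial>lborel)"
    by (intro nn_integral_cong) (simp add: laplace split: split_indicator)
  also have "\<dots> = ennreal (Gamma (1 - b / q) / b) * (\<integral>\<^sup>+w. ennreal (Y w powr (b / q)) \<partial>N)"
    using N b(1,3) by (rule low_moment_via_laplace[symmetric])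
  finally have "ennreal b * (ennreal (Gamma (1 - b) / b) * (\<integral>\<^sup>+w. ennreal (X w powr b) \<partial>M))
      = ennreal b * (ennreal (Gamma (1 - b / q) / b) * (\<integral>\<^sup>+w. ennreal (Y w powr (b / q)) \<partial>N))"
    by simp
  then show ?thesis
    using b by (simp add: mult.assoc[symmetric] ennreal_mult'[symmetric] del: ennreal_mult_cancel_left)
qed

section \<open>The Gamma distribution\<close>

text \<open>
  The Gamma distribution with shape $a$ and rate $1$, carried by the half-line but formally a
  measure on all of $\mathbb{R}$; integrands below are written with \<^term>\<open>\<bar>x\<bar>\<close> so that they are
  nonnegative everywhere.
\<close>
definition gamma_dist :: "real \<Rightarrow> real measure" where
  "gamma_dist a = density lborel (\<lambda>x. ennreal (indicator {0..} x * x powr (a - 1) / exp x / Gamma a))"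

text \<open>
  The weight $e^{-sx}$ changes the rate from $1$ to $1 + s$; rescaling by $1 + s$ turns the integral
  into the one defining $\Gamma(a+b)$. The case $b = 0$ gives the total mass and the Laplace transform,
  the case $s = 0$ the moments.
\<close>
lemma nn_integral_gamma_dist:
  fixes a b s :: real
  assumes a: "0 < a" and b: "0 \<le> b" and s: "0 \<le> s"
  shows "(\<integral>\<^sup>+x. ennreal (exp (- (s * \<bar>x\<bar>)) * \<bar>x\<bar> powr b) \<partial>gamma_dist a)
         = ennreal (Gamma (a + b) / Gamma a * (1 + s) powr (- (a + b)))"
proof -
  have G: "0 < Gamma a" using a by (rule Gamma_real_pos)
  have s1: "0 < 1 + s" using s by simp
  have "(\<integral>\<^sup>+x. ennreal (exp (- (s * \<bar>x\<bar>)) * \<bar>x\<bar> powr b) \<partial>gamma_dist a)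
      = (\<integral>\<^sup>+x. ennreal (indicator {0..} x * x powr (a - 1) / exp x / Gamma a)
                * ennreal (exp (- (s * \<bar>x\<bar>)) * \<bar>x\<bar> powr b) \<partial>lborel)"
    unfolding gamma_dist_def by (subst nn_integral_density) auto
  also have "\<dots> = ennreal (1 / (1 + s)) * (\<integral>\<^sup>+y. ennreal (1 / Gamma a * (1 + s) powr (1 - a - b)) *
                ennreal (indicator {0..} y * y powr ((a + b) - 1) / exp y) \<partial>lborel)"
  proof (subst nn_integral_real_affine[where c = "1 / (1 + s)" and t = 0])
    have "ennreal (indicator {0..} (y / (1 + s)) * (y / (1 + s)) powr (a - 1) / exp (y / (1 + s)) / Gamma a)
              * ennreal (exp (- (s * \<bar>y / (1 + s)\<bar>)) * \<bar>y / (1 + s)\<bar> powr b)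
        = ennreal (1 / Gamma a * (1 + s) powr (1 - a - b)) *
            ennreal (indicator {0..} y * y powr ((a + b) - 1) / exp y)" for y
    proof (cases "0 < y")
      case False
      \<comment> \<open>At $0$ both sides vanish, since \<^term>\<open>(0::real) powr c = 0\<close> for every exponent, including $0$.\<close>
      then have "y < 0 \<or> y = 0" by auto
      then show ?thesis using s1 by (auto simp: indicator_def zero_le_divide_iff)
    next
      case y: True
      have e: "exp (- (s * (y / (1 + s)))) / exp (y / (1 + s)) = 1 / exp y"
      proof -
        have "- (s * (y / (1 + s))) - y / (1 + s) = - (((1 + s) * y) / (1 + s))"
          by (simp add: add_divide_distrib ring_distribs)
        also have "\<dots> = - y" using s1 by simp
        finally have "exp (- (s * (y / (1 + s)))) / exp (y / (1 + s)) = exp (- y)"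
          by (simp only: exp_diff[symmetric])
        also have "exp (- y) = 1 / exp y" by (simp add: exp_minus inverse_eq_divide)
        finally show ?thesis .
      qed
      have p: "(y / (1 + s)) powr (a - 1) * (y / (1 + s)) powr b = (1 + s) powr (1 - a - b) * y powr ((a + b) - 1)"
        using y s1 powr_minus_divide[of "1 + s" "(a + b) - 1"]
        by (simp add: powr_add[symmetric] powr_divide) (simp add: algebra_simps)
      have "(y / (1 + s)) powr (a - 1) / exp (y / (1 + s)) / Gamma a * (exp (- (s * (y / (1 + s)))) * (y / (1 + s)) powr b)
          = ((y / (1 + s)) powr (a - 1) * (y / (1 + s)) powr b) * (exp (- (s * (y / (1 + s)))) / exp (y / (1 + s))) / Gamma a"
        by simp
      also have "\<dots> = 1 / Gamma a * (1 + s) powr (1 - a - b) * (y powr ((a + b) - 1) / exp y)"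
        unfolding e p by simp
      finally show ?thesis
        using y s1 G by (simp add: ennreal_mult[symmetric] zero_le_divide_iff)
    qed
    then show "ennreal \<bar>1 / (1 + s)\<bar> * (\<integral>\<^sup>+y. ennreal (indicator {0..} (0 + 1 / (1 + s) * y) * (0 + 1 / (1 + s) * y) powr (a - 1)
            / exp (0 + 1 / (1 + s) * y) / Gamma a)
            * ennreal (exp (- (s * \<bar>0 + 1 / (1 + s) * y\<bar>)) * \<bar>0 + 1 / (1 + s) * y\<bar> powr b) \<partial>lborel)
      = ennreal (1 / (1 + s)) * (\<integral>\<^sup>+y. ennreal (1 / Gamma a * (1 + s) powr (1 - a - b)) *
                ennreal (indicator {0..} y * y powr ((a + b) - 1) / exp y) \<partial>lborel)"
      using s1 by simp
  qed (use s1 in auto)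
  also have "\<dots> = ennreal (1 / (1 + s)) * (ennreal (1 / Gamma a * (1 + s) powr (1 - a - b)) * ennreal (Gamma (a + b)))"
    using a b by (subst nn_integral_cmult) (auto simp: Gamma_conv_nn_integral_real)
  also have "\<dots> = ennreal (1 / (1 + s) * (1 / Gamma a * (1 + s) powr (1 - a - b) * Gamma (a + b)))"
    using s1 G a b by (simp add: ennreal_mult[symmetric] Gamma_real_pos less_imp_le)
  also have "1 / (1 + s) * (1 / Gamma a * (1 + s) powr (1 - a - b) * Gamma (a + b))
      = Gamma (a + b) / Gamma a * ((1 + s) powr (- 1) * (1 + s) powr (1 - a - b))"
    using s1 by (simp add: powr_minus field_simps)
  also have "(1 + s) powr (- 1) * (1 + s) powr (1 - a - b) = (1 + s) powr (- (a + b))"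
    by (simp only: powr_add[symmetric]) (simp add: algebra_simps)
  finally show ?thesis .
qed

lemma prob_space_gamma_dist:
  assumes "0 < a"
  shows "prob_space (gamma_dist a)"
proof
  have "emeasure (gamma_dist a) (space (gamma_dist a)) = (\<integral>\<^sup>+x. 1 \<partial>gamma_dist a)"
    by simp
  also have "\<dots> = (\<integral>\<^sup>+x. ennreal (exp (- (0 * \<bar>x\<bar>)) * \<bar>x\<bar> powr 0) \<partial>gamma_dist a)"
    \<comment> \<open>The factor \<^term>\<open>\<bar>x\<bar> powr 0\<close> is $1$ except at the null point $0$.\<close>
    unfolding gamma_dist_def by (intro nn_integral_cong_AE AE_density[THEN iffD2])
       (use AE_lborel_singleton[of "0::real"] in \<open>auto elim!: eventually_mono\<close>)
  also have "\<dots> = 1"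
    using assms less_imp_neq[OF Gamma_real_pos[of a]] by (subst nn_integral_gamma_dist) auto
  finally show "emeasure (gamma_dist a) (space (gamma_dist a)) = 1" .
qed

lemma laplace_gamma_dist:
  assumes a: "0 < a" and s: "0 \<le> s"
  shows "(\<integral>x. exp (- (s * \<bar>x\<bar>)) \<partial>gamma_dist a) = (1 + s) powr (- a)"
proof -
  have "(\<integral>\<^sup>+x. ennreal (exp (- (s * \<bar>x\<bar>))) \<partial>gamma_dist a)
      = (\<integral>\<^sup>+x. ennreal (exp (- (s * \<bar>x\<bar>)) * \<bar>x\<bar> powr 0) \<partial>gamma_dist a)"
    unfolding gamma_dist_def by (intro nn_integral_cong_AE AE_density[THEN iffD2])
       (use AE_lborel_singleton[of "0::real"] in \<open>auto elim!: eventually_mono\<close>)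
  also have "\<dots> = ennreal ((1 + s) powr (- a))"
    using a s less_imp_neq[OF Gamma_real_pos[of a]] by (subst nn_integral_gamma_dist) auto
  finally show ?thesis
    by (subst integral_eq_nn_integral) (auto simp: gamma_dist_def)
qed

section \<open>The standard Gaussian vector\<close>

definition gauss_vec :: "(real ^ 'd::finite) measure" where
  "gauss_vec = distr (Pi\<^sub>M UNIV (\<lambda>_. std_normal_distribution)) borel (\<lambda>w. \<chi> i. w i)"

lemma measurable_vec_lambda_PiM[measurable]:
  "(\<lambda>w. \<chi> i. w i) \<in> Pi\<^sub>M (UNIV :: 'd::finite set) (\<lambda>_. std_normal_distribution) \<rightarrow>\<^sub>M (borel :: (real ^ 'd) measure)"
proof (rule borel_measurable_euclidean_space[THEN iffD2], rule ballI)
  fix b :: "real ^ 'd" assume "b \<in> Basis"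
  then obtain i where b: "b = axis i 1" by (auto simp: Basis_vec_def)
  have "(\<lambda>w. w i) \<in> Pi\<^sub>M (UNIV :: 'd set) (\<lambda>_. std_normal_distribution) \<rightarrow>\<^sub>M std_normal_distribution"
    by (rule measurable_component_singleton) simp
  then show "(\<lambda>w. (\<chi> i. w i) \<bullet> b) \<in> borel_measurable (Pi\<^sub>M UNIV (\<lambda>_. std_normal_distribution))"
    by (simp add: b inner_axis)
qed

lemma product_prob_space_std_normal: "product_prob_space (\<lambda>_::'d. std_normal_distribution)"
  using real_dist_normal_dist
  by (simp add: product_prob_space_def product_sigma_finite_def product_prob_space_axioms_def
      real_distribution_def prob_space_imp_sigma_finite)

lemma prob_space_gauss_vec: "prob_space (gauss_vec :: (real ^ 'd::finite) measure)"
proof -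
  interpret product_prob_space "\<lambda>_::'d. std_normal_distribution" by (rule product_prob_space_std_normal)
  show ?thesis unfolding gauss_vec_def
    by (rule prob_space.prob_space_distr[OF prob_space_PiM]) (rule M.prob_space_axioms, rule measurable_vec_lambda_PiM)
qed

lemma sets_gauss_vec[measurable_cong, simp]: "sets gauss_vec = sets borel"
  by (simp add: gauss_vec_def)

lemma integral_gauss_vec_prod:
  fixes f :: "'d::finite \<Rightarrow> real \<Rightarrow> 'a :: {real_normed_field, banach, second_countable_topology}"
  assumes f[measurable]: "\<And>i. f i \<in> borel_measurable borel"
    and int: "\<And>i. integrable std_normal_distribution (f i)"
  shows "(\<integral>x. (\<Prod>i\<in>UNIV. f i (x $ i)) \<partial>gauss_vec) = (\<Prod>i\<in>UNIV. \<integral>x. f i x \<partial>std_normal_distribution)"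
proof -
  interpret product_prob_space "\<lambda>_::'d. std_normal_distribution" by (rule product_prob_space_std_normal)
  have [measurable]: "(\<lambda>x::real^'d. x $ i) \<in> borel_measurable borel" for i
    by (intro borel_measurable_continuous_onI continuous_intros)
  have "(\<integral>x. (\<Prod>i\<in>UNIV. f i (x $ i)) \<partial>gauss_vec)
      = (\<integral>w. (\<Prod>i\<in>UNIV. f i (w i)) \<partial>Pi\<^sub>M UNIV (\<lambda>_. std_normal_distribution))"
    unfolding gauss_vec_def by (subst integral_distr) auto
  also have "\<dots> = (\<Prod>i\<in>UNIV. \<integral>x. f i x \<partial>std_normal_distribution)"
    using int by (intro product_integral_prod) auto
  finally show ?thesis .
qed

text \<open>
  This is what turns a Gaussian damping factor in $v$ into an average of the exponentials
  $e^{-i v\cdot x}$, that is, of the integrands of the Fourier transform.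
\<close>
lemma char_gauss_vec:
  fixes v :: "real ^ 'd::finite"
  shows "(\<integral>x. exp (- (\<i> * complex_of_real (v \<bullet> x))) \<partial>gauss_vec) = complex_of_real (exp (- ((norm v)\<^sup>2 / 2)))"
proof -
  interpret N: real_distribution std_normal_distribution by (rule real_dist_normal_dist)
  have "(\<integral>x. exp (- (\<i> * complex_of_real (v \<bullet> x))) \<partial>gauss_vec)
      = (\<integral>x. (\<Prod>i\<in>UNIV. exp (\<i> * complex_of_real (- (v $ i) * x $ i))) \<partial>gauss_vec)"
    by (simp add: inner_vec_def exp_sum[symmetric] sum_negf sum_distrib_left)
  also have "\<dots> = (\<Prod>i\<in>UNIV. char std_normal_distribution (- (v $ i)))"
    unfolding char_def
  proof (rule integral_gauss_vec_prod)
    show "integrable std_normal_distribution (\<lambda>x. exp (\<i> * complex_of_real (- (v $ i) * x)))" for i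
      by (rule N.integrable_iexp) auto
  qed simp
  also have "\<dots> = complex_of_real (\<Prod>i\<in>UNIV. exp (- ((v $ i)\<^sup>2 / 2)))"
    by (simp add: char_std_normal_distribution del: of_real_exp)
  also have "(\<Prod>i\<in>UNIV. exp (- ((v $ i)\<^sup>2 / 2))) = exp (- ((norm v)\<^sup>2 / 2))"
    by (simp add: exp_sum[symmetric] power2_norm_eq_inner inner_vec_def power2_eq_square[symmetric]
        sum_negf sum_divide_distrib)
  finally show ?thesis .
qed

lemma laplace_std_normal_square:
  assumes s: "0 \<le> s"
  shows "(\<integral>x. exp (- (s * (x\<^sup>2 / 2))) \<partial>std_normal_distribution) = (1 + s) powr (- (1 / 2))"
proof -
  define c where "c = 1 / sqrt (1 + s)"
  have c: "0 < c" and c2: "c\<^sup>2 = 1 / (1 + s)" using s by (simp_all add: c_def power_divide)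
  have "(\<integral>x. exp (- (s * (x\<^sup>2 / 2))) \<partial>std_normal_distribution)
      = (\<integral>x. std_normal_density x * exp (- (s * (x\<^sup>2 / 2))) \<partial>lborel)"
    by (subst integral_density) auto
  also have "\<dots> = (\<integral>x. c * normal_density 0 c x \<partial>lborel)"
  proof (intro Bochner_Integration.integral_cong refl)
    fix x :: real
    have "normal_density 0 c x = 1 / (c * sqrt (2 * pi)) * exp (- (x\<^sup>2 * (1 + s)) / 2)"
    proof -
      have "sqrt (2 * pi * c\<^sup>2) = c * sqrt (2 * pi)" using c by (simp add: real_sqrt_mult)
      moreover have "- (x - 0)\<^sup>2 / (2 * c\<^sup>2) = - (x\<^sup>2 * (1 + s)) / 2" by (simp add: c2)
      ultimately show ?thesis by (simp only: normal_density_def)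
    qed
    then show "std_normal_density x * exp (- (s * (x\<^sup>2 / 2))) = c * normal_density 0 c x"
      using c by (simp add: std_normal_density_def exp_add[symmetric] field_simps)
  qed
  also have "\<dots> = c" using integral_normal_density[OF c, of 0] by simp
  also have "c = (1 + s) powr (- (1 / 2))"
    using s by (simp add: c_def powr_minus_divide powr_half_sqrt)
  finally show ?thesis .
qed

lemma laplace_gauss_vec_square:
  assumes s: "0 \<le> s"
  shows "(\<integral>x. exp (- (s * ((norm x)\<^sup>2 / 2))) \<partial>(gauss_vec :: (real ^ 'd::finite) measure)) = (1 + s) powr (- (real CARD('d) / 2))"
proof -
  interpret N: real_distribution std_normal_distribution by (rule real_dist_normal_dist)
  have "(\<integral>x. exp (- (s * ((norm x)\<^sup>2 / 2))) \<partial>(gauss_vec :: (real ^ 'd) measure))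
      = (\<integral>x. (\<Prod>i\<in>UNIV. exp (- (s * ((x $ i)\<^sup>2 / 2)))) \<partial>(gauss_vec :: (real ^ 'd) measure))"
    by (simp add: exp_sum[symmetric] power2_norm_eq_inner inner_vec_def power2_eq_square[symmetric]
        sum_negf sum_divide_distrib sum_distrib_left)
  also have "\<dots> = (\<Prod>i\<in>(UNIV::'d set). \<integral>x. exp (- (s * (x\<^sup>2 / 2))) \<partial>std_normal_distribution)"
    using s by (intro integral_gauss_vec_prod N.integrable_const_bound[of _ 1]) auto
  also have "\<dots> = ((1 + s) powr (- (1 / 2))) ^ CARD('d)"
    by (simp only: laplace_std_normal_square[OF s] prod_constant)
  also have "\<dots> = (1 + s) powr (- (real CARD('d) / 2))"
    using s by (simp add: powr_powr powr_realpow[symmetric])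
  finally show ?thesis .
qed

text \<open>
  Half the squared norm of a standard Gaussian vector has the Laplace transform
  $(1+s)^{-d/2}$ of the Gamma distribution with shape $d/2$, hence its moments.
\<close>
lemma gauss_vec_norm_moment:
  assumes a: "0 < a"
  shows "(\<integral>\<^sup>+x. ennreal (norm x powr a) \<partial>(gauss_vec :: (real ^ 'd::finite) measure))
     = ennreal (2 powr (a / 2) * Gamma ((a + real CARD('d)) / 2) / Gamma (real CARD('d) / 2))"
proof -
  have [measurable]: "(\<lambda>x::real^'d. norm x) \<in> borel_measurable gauss_vec" by simp
  define c where "c = real CARD('d) / 2"
  have c: "0 < c" by (simp add: c_def)
  have "(\<integral>\<^sup>+x. ennreal (((norm x)\<^sup>2 / 2) powr (a / 2)) \<partial>(gauss_vec :: (real ^ 'd::finite) measure))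
      = (\<integral>\<^sup>+x. ennreal (\<bar>x\<bar> powr (a / 2)) \<partial>gamma_dist c)"
  proof (rule moment_eq_of_laplace_eq[OF prob_space_gauss_vec _ _ prob_space_gamma_dist[OF c]])
    show "(\<integral>x. exp (- (s * ((norm x)\<^sup>2 / 2))) \<partial>(gauss_vec :: (real ^ 'd) measure))
        = (\<integral>x. exp (- (s * \<bar>x\<bar>)) \<partial>gamma_dist c)" if "0 < s" for s
      using that c by (simp only: laplace_gauss_vec_square laplace_gamma_dist less_imp_le c_def)
  qed (use a in \<open>auto simp: gamma_dist_def\<close>)
  also have "\<dots> = (\<integral>\<^sup>+x. ennreal (exp (- (0 * \<bar>x\<bar>)) * \<bar>x\<bar> powr (a / 2)) \<partial>gamma_dist c)"
    by simp
  also have "\<dots> = ennreal (Gamma (c + a / 2) / Gamma c)"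
    using a c by (subst nn_integral_gamma_dist) auto
  finally have *: "(\<integral>\<^sup>+x. ennreal (((norm x)\<^sup>2 / 2) powr (a / 2)) \<partial>(gauss_vec :: (real ^ 'd::finite) measure))
      = ennreal (Gamma (c + a / 2) / Gamma c)" .
  have "norm x powr a = 2 powr (a / 2) * ((norm x)\<^sup>2 / 2) powr (a / 2)" for x :: "real ^ 'd"
    by (cases "x = 0") (simp_all add: powr_divide powr_powr flip: powr_numeral)
  then have "(\<integral>\<^sup>+x. ennreal (norm x powr a) \<partial>(gauss_vec :: (real ^ 'd::finite) measure))
      = ennreal (2 powr (a / 2)) * ennreal (Gamma (c + a / 2) / Gamma c)"
    by (simp add: ennreal_mult nn_integral_cmult *)
  also have "\<dots> = ennreal (2 powr (a / 2) * (Gamma (c + a / 2) / Gamma c))"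
    using a c by (intro ennreal_mult[symmetric]) (auto intro!: divide_nonneg_nonneg less_imp_le Gamma_real_pos)
  also have "c + a / 2 = (a + real CARD('d)) / 2" by (simp add: c_def field_simps)
  finally show ?thesis by (simp add: c_def)
qed

section \<open>Schoenberg representations and moments\<close>

lemma borel_prob_on_UNIV_D:
  assumes "borel_prob_on UNIV \<mu>"
  shows "prob_space \<mu>" "sets \<mu> = sets borel"
  using assms by (simp_all add: borel_prob_on_def)

lemma borel_prob_on_nonneg_D:
  fixes \<nu> :: "real measure"
  assumes "borel_prob_on {0..} \<nu>"
  shows "prob_space \<nu>" "space \<nu> = {0..}" "(\<lambda>t. t) \<in> borel_measurable \<nu>"
proof -
  have sets_\<nu>: "sets \<nu> = sets (restrict_space borel {0..})"
    using assms by (simp add: borel_prob_on_def)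
  show "prob_space \<nu>" using assms by (simp add: borel_prob_on_def)
  show "space \<nu> = {0..}"
    using sets_eq_imp_space_eq[OF sets_\<nu>] by (simp add: space_restrict_space)
  show "(\<lambda>t. t) \<in> borel_measurable \<nu>"
    by (subst measurable_cong_sets[OF sets_\<nu> refl])
      (rule measurable_restrict_space1[OF measurable_ident_sets[OF refl]])
qed

text \<open>
  The bridge between the two measures: with $G$ standard Gaussian,
  $e^{-s|v|^2/2} = E\,e^{-i\sqrt s\,v\cdot G}$, so by Fubini the left-hand side is
  $E\,\phi(\sqrt s\,G)$, and the Schoenberg representation rewrites it as the expectation of
  $\exp(-t\,s^{p/2}|G|^p)$ over $t \sim \nu$ and $G$. For $p = 2$ it is a Laplace transform at $s$, for
  $p < 2$ one at $s^{p/2}$.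
\<close>
lemma laplace_square_via_schoenberg:
  fixes \<mu> :: "(real ^ 'd::finite) measure"
  assumes \<nu>: "borel_prob_on {0..} \<nu>" "schoenberg_rep p \<nu> \<phi>"
    and \<mu>: "borel_prob_on UNIV \<mu>" "fourier_measure \<mu> = \<phi>"
    and s: "0 \<le> s"
  shows "(\<integral>v. exp (- (s * ((norm v)\<^sup>2 / 2))) \<partial>\<mu>)
       = (\<integral>z. exp (- (s powr (p / 2) * (snd z * norm (fst z) powr p))) \<partial>((gauss_vec :: (real ^ 'd) measure) \<Otimes>\<^sub>M \<nu>))"
proof -
  interpret \<mu>: prob_space \<mu> using \<mu>(1) by (rule borel_prob_on_UNIV_D)
  interpret \<nu>: prob_space \<nu> using \<nu>(1) by (rule borel_prob_on_nonneg_D)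
  interpret G: prob_space "gauss_vec :: (real ^ 'd) measure" by (rule prob_space_gauss_vec)
  interpret P: pair_prob_space \<mu> "gauss_vec :: (real ^ 'd) measure" ..
  interpret Q: pair_prob_space "gauss_vec :: (real ^ 'd) measure" \<nu> ..
  note [measurable_cong] = borel_prob_on_UNIV_D(2)[OF \<mu>(1)]
  note [measurable] = borel_prob_on_nonneg_D(3)[OF \<nu>(1)]
  note space_\<nu> = borel_prob_on_nonneg_D(2)[OF \<nu>(1)]
  have [measurable]: "(\<lambda>z. snd z) \<in> borel_measurable ((gauss_vec :: (real ^ 'd) measure) \<Otimes>\<^sub>M \<nu>)"
    by (rule measurable_compose[OF measurable_snd]) measurable
  have "complex_of_real (\<integral>v. exp (- (s * ((norm v)\<^sup>2 / 2))) \<partial>\<mu>)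
      = (\<integral>v. (\<integral>x. exp (- (\<i> * complex_of_real ((sqrt s *\<^sub>R v) \<bullet> x))) \<partial>gauss_vec) \<partial>\<mu>)"
    using s by (subst char_gauss_vec)
      (simp add: power_mult_distrib del: of_real_exp flip: integral_complex_of_real)
  also have "\<dots> = (\<integral>x. (\<integral>v. exp (- (\<i> * complex_of_real ((sqrt s *\<^sub>R v) \<bullet> x))) \<partial>\<mu>) \<partial>gauss_vec)"
    by (rule P.Fubini_integral[symmetric], rule P.integrable_const_bound[of _ 1]) (auto simp: case_prod_unfold norm_exp_eq_Re)
  also have "\<dots> = (\<integral>x. \<phi> (sqrt s *\<^sub>R x) \<partial>gauss_vec)"
    unfolding \<mu>(2)[symmetric] fourier_measure_def by (simp add: inner_commute)
  also have "\<dots> = complex_of_real (\<integral>x. (\<integral>t. exp (- t * norm (sqrt s *\<^sub>R x) powr p) \<partial>\<nu>) \<partial>(gauss_vec :: (real ^ 'd) measure))"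
    using \<nu>(2) by (simp add: schoenberg_rep_def flip: integral_complex_of_real)
  also have "(\<integral>x. (\<integral>t. exp (- t * norm (sqrt s *\<^sub>R x) powr p) \<partial>\<nu>) \<partial>(gauss_vec :: (real ^ 'd) measure))
     = (\<integral>x. (\<integral>t. exp (- (s powr (p / 2) * (snd (x, t) * norm (fst (x, t)) powr p))) \<partial>\<nu>) \<partial>(gauss_vec :: (real ^ 'd) measure))"
    using s by (simp add: powr_mult powr_powr mult_ac flip: powr_half_sqrt)
  also have "\<dots> = (\<integral>z. exp (- (s powr (p / 2) * (snd z * norm (fst z) powr p))) \<partial>((gauss_vec :: (real ^ 'd) measure) \<Otimes>\<^sub>M \<nu>))"
    by (rule Q.integral_fst', rule Q.integrable_const_bound[of _ 1]) (auto simp: space_pair_measure space_\<nu>)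
  finally show ?thesis by (simp only: of_real_eq_iff)
qed

theorem proposition8p2:
  fixes p :: real
    and \<phi> :: "real ^ 'd \<Rightarrow> complex"
    and \<nu> :: "real measure"
    and \<mu> :: "(real ^ 'd) measure"
  assumes "0 < p" and "p \<le> 2"
    and "\<phi> \<in> schoenberg_class p"
    and "borel_prob_on {0..} \<nu>"
    and "schoenberg_rep p \<nu> \<phi>"
    and "borel_prob_on UNIV \<mu>"
    and "fourier_measure \<mu> = \<phi>"
  shows "(\<forall>\<alpha>::real. 0 < \<alpha> \<and> \<alpha> < p \<and> p < 2 \<longrightarrow>
            (\<integral>\<^sup>+v. ennreal (rpow (norm v) \<alpha>) \<partial>\<mu>) =
              ennreal (2 powr \<alpha> * Gamma (1 - \<alpha> / p) * Gamma ((\<alpha> + real CARD('d)) / 2)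
                / (Gamma (1 - \<alpha> / 2) * Gamma (real CARD('d) / 2)))
              * (\<integral>\<^sup>+t. ennreal (rpow t (\<alpha> / p)) \<partial>\<nu>)) \<and>
         (\<forall>\<alpha>::real. p = 2 \<and> 0 \<le> \<alpha> \<longrightarrow>
            (\<integral>\<^sup>+v. ennreal (rpow (norm v) \<alpha>) \<partial>\<mu>) =
              ennreal (2 powr \<alpha> * Gamma ((\<alpha> + real CARD('d)) / 2) / Gamma (real CARD('d) / 2))
              * (\<integral>\<^sup>+t. ennreal (rpow t (\<alpha> / p)) \<partial>\<nu>))"
proof -
  interpret \<mu>: prob_space \<mu> using assms(6) by (rule borel_prob_on_UNIV_D)
  interpret \<nu>: prob_space \<nu> using assms(4) by (rule borel_prob_on_nonneg_D)
  interpret G: prob_space "gauss_vec :: (real ^ 'd) measure" by (rule prob_space_gauss_vec)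
  interpret Q: pair_prob_space "gauss_vec :: (real ^ 'd) measure" \<nu> ..
  note [measurable_cong] = borel_prob_on_UNIV_D(2)[OF assms(6)]
  note [measurable] = borel_prob_on_nonneg_D(3)[OF assms(4)]
  note space_\<nu> = borel_prob_on_nonneg_D(2)[OF assms(4)]
  have [measurable]: "(\<lambda>z. snd z) \<in> borel_measurable ((gauss_vec :: (real ^ 'd) measure) \<Otimes>\<^sub>M \<nu>)"
    by (rule measurable_compose[OF measurable_snd]) measurable
  define X where "X v = (norm v)\<^sup>2 / 2" for v :: "real ^ 'd"
  define Y where "Y z = snd z * norm (fst z) powr p" for z :: "(real ^ 'd) \<times> real"
  define d where "d = real CARD('d)"
  have d: "0 < d" by (simp add: d_def)
  have "X \<in> borel_measurable \<mu>"
    unfolding X_def by measurable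
  then have X: "X \<in> borel_measurable \<mu>" "\<And>v. v \<in> space \<mu> \<Longrightarrow> 0 \<le> X v"
    by (auto simp: X_def)
  have "Y \<in> borel_measurable (gauss_vec \<Otimes>\<^sub>M \<nu>)"
    unfolding Y_def by measurable
  then have Y: "Y \<in> borel_measurable (gauss_vec \<Otimes>\<^sub>M \<nu>)" "\<And>z. z \<in> space (gauss_vec \<Otimes>\<^sub>M \<nu>) \<Longrightarrow> 0 \<le> Y z"
    by (auto simp: Y_def space_pair_measure space_\<nu>)
  have laplace: "(\<integral>v. exp (- (s * X v)) \<partial>\<mu>) = (\<integral>z. exp (- (s powr (p / 2) * Y z)) \<partial>(gauss_vec \<Otimes>\<^sub>M \<nu>))"
    if "0 < s" for s
    unfolding X_def Y_def using that assms(4-7) by (intro laplace_square_via_schoenberg) auto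

  have X_moment: "(\<integral>\<^sup>+v. ennreal (rpow (norm v) a) \<partial>\<mu>) = ennreal (2 powr (a / 2)) * (\<integral>\<^sup>+v. ennreal (X v powr (a / 2)) \<partial>\<mu>)"
    if a: "0 < a" for a
  proof -
    have "rpow (norm v) a = 2 powr (a / 2) * X v powr (a / 2)" for v :: "real ^ 'd"
      using a by (cases "v = 0") (simp_all add: rpow_def X_def powr_divide powr_powr flip: powr_numeral)
    then show ?thesis
      using X(1) by (simp add: ennreal_mult nn_integral_cmult)
  qed

  have Y_moment: "(\<integral>\<^sup>+z. ennreal (Y z powr (a / p)) \<partial>(gauss_vec \<Otimes>\<^sub>M \<nu>))
      = ennreal (2 powr (a / 2) * Gamma ((a + d) / 2) / Gamma (d / 2)) * (\<integral>\<^sup>+t. ennreal (rpow t (a / p)) \<partial>\<nu>)"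
    if a: "0 < a" for a
  proof -
    have "(\<integral>\<^sup>+z. ennreal (Y z powr (a / p)) \<partial>(gauss_vec \<Otimes>\<^sub>M \<nu>))
        = (\<integral>\<^sup>+x. (\<integral>\<^sup>+t. ennreal (Y (x, t) powr (a / p)) \<partial>\<nu>) \<partial>gauss_vec)"
      by (intro \<nu>.nn_integral_fst[symmetric]
          measurable_compose[OF Y(1), of "\<lambda>y. ennreal (y powr (a / p))"]) measurable
    also have "\<dots> = (\<integral>\<^sup>+x. (\<integral>\<^sup>+t. ennreal (norm x powr a) * ennreal (rpow t (a / p)) \<partial>\<nu>) \<partial>(gauss_vec :: (real ^ 'd) measure))"
      using a assms(1) by (intro nn_integral_cong)
        (auto simp: Y_def space_\<nu> rpow_def powr_mult powr_powr ennreal_mult[symmetric] mult.commute)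
    also have "\<dots> = (\<integral>\<^sup>+x. ennreal (norm x powr a) \<partial>(gauss_vec :: (real ^ 'd) measure)) * (\<integral>\<^sup>+t. ennreal (rpow t (a / p)) \<partial>\<nu>)"
      unfolding rpow_def by (simp add: nn_integral_cmult nn_integral_multc)
    finally show ?thesis
      unfolding gauss_vec_norm_moment[OF a] by (simp add: d_def)
  qed

  show ?thesis
    unfolding d_def[symmetric]
  proof (intro conjI allI impI; elim conjE)
    fix \<alpha> :: real
    assume \<alpha>: "0 < \<alpha>" "\<alpha> < p" and p: "p < 2"
    have G: "0 < Gamma (1 - \<alpha> / 2)" "0 < Gamma (1 - \<alpha> / p)" "0 < Gamma ((\<alpha> + d) / 2)" "0 < Gamma (d / 2)"
      using \<alpha> p d assms(1) by (auto intro!: Gamma_real_pos)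
    define I where "I = (\<integral>\<^sup>+t. ennreal (rpow t (\<alpha> / p)) \<partial>\<nu>)"
    define J where "J = (\<integral>\<^sup>+v. ennreal (X v powr (\<alpha> / 2)) \<partial>\<mu>)"
    \<comment> \<open>The order $\alpha/2$ is below $q = p/2$ exactly because $\alpha < p$.\<close>
    have "ennreal (Gamma (1 - \<alpha> / 2)) * J
        = ennreal (Gamma (1 - (\<alpha> / 2) / (p / 2)))
          * (\<integral>\<^sup>+z. ennreal (Y z powr ((\<alpha> / 2) / (p / 2))) \<partial>(gauss_vec \<Otimes>\<^sub>M \<nu>))"
      unfolding J_def using \<alpha> p
      by (intro low_moment_of_laplace_powr[OF \<mu>.prob_space_axioms X Q.prob_space_axioms Y laplace]) auto
    also have "\<dots> = ennreal (Gamma (1 - \<alpha> / p)) * (ennreal (2 powr (\<alpha> / 2) * Gamma ((\<alpha> + d) / 2) / Gamma (d / 2)) * I)"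
      using Y_moment[OF \<alpha>(1)] by (simp add: I_def)
    finally have *: "ennreal (Gamma (1 - \<alpha> / 2)) * J
        = ennreal (Gamma (1 - \<alpha> / p)) * (ennreal (2 powr (\<alpha> / 2) * Gamma ((\<alpha> + d) / 2) / Gamma (d / 2)) * I)" .
    have "ennreal (2 powr (\<alpha> / 2)) * J
        = ennreal (2 powr (\<alpha> / 2) / Gamma (1 - \<alpha> / 2)) * (ennreal (Gamma (1 - \<alpha> / 2)) * J)"
      using G by (simp add: mult.assoc[symmetric] ennreal_mult[symmetric])
    also have "\<dots> = ennreal (2 powr (\<alpha> / 2) / Gamma (1 - \<alpha> / 2) * (Gamma (1 - \<alpha> / p)
          * (2 powr (\<alpha> / 2) * Gamma ((\<alpha> + d) / 2) / Gamma (d / 2)))) * I"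
      unfolding * using G by (simp add: mult.assoc[symmetric] ennreal_mult[symmetric])
    also have "2 powr (\<alpha> / 2) / Gamma (1 - \<alpha> / 2) * (Gamma (1 - \<alpha> / p)
          * (2 powr (\<alpha> / 2) * Gamma ((\<alpha> + d) / 2) / Gamma (d / 2)))
        = (2 powr (\<alpha> / 2) * 2 powr (\<alpha> / 2)) * Gamma (1 - \<alpha> / p) * Gamma ((\<alpha> + d) / 2)
                / (Gamma (1 - \<alpha> / 2) * Gamma (d / 2))"
      by (simp add: mult_ac)
    also have "2 powr (\<alpha> / 2) * 2 powr (\<alpha> / 2) = (2 powr \<alpha> :: real)"
      by (simp flip: powr_add)
    finally show "(\<integral>\<^sup>+v. ennreal (rpow (norm v) \<alpha>) \<partial>\<mu>)
      = ennreal (2 powr \<alpha> * Gamma (1 - \<alpha> / p) * Gamma ((\<alpha> + d) / 2) / (Gamma (1 - \<alpha> / 2) * Gamma (d / 2)))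
        * (\<integral>\<^sup>+t. ennreal (rpow t (\<alpha> / p)) \<partial>\<nu>)"
      unfolding X_moment[OF \<alpha>(1)] J_def I_def .
  next
    fix \<alpha> :: real
    assume p: "p = 2" and \<alpha>: "0 \<le> \<alpha>"
    show "(\<integral>\<^sup>+v. ennreal (rpow (norm v) \<alpha>) \<partial>\<mu>)
      = ennreal (2 powr \<alpha> * Gamma ((\<alpha> + d) / 2) / Gamma (d / 2)) * (\<integral>\<^sup>+t. ennreal (rpow t (\<alpha> / p)) \<partial>\<nu>)"
    \<comment> \<open>Order $0$ is separate: both sides are total masses, and the kernel $s^{-b-1}$ needs $b > 0$.\<close>
    proof (cases "\<alpha> = 0")
      case True
      have "Gamma (d / 2) \<noteq> 0" using d less_imp_neq[OF Gamma_real_pos[of "d / 2"]] by auto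
      with True show ?thesis by (simp add: rpow_def \<mu>.emeasure_space_1 \<nu>.emeasure_space_1)
    next
      case False
      with \<alpha> have \<alpha>: "0 < \<alpha>" by simp
      have G: "0 < Gamma ((\<alpha> + d) / 2)" "0 < Gamma (d / 2)"
        using \<alpha> d by (auto intro!: Gamma_real_pos)
      have "(\<integral>\<^sup>+v. ennreal (X v powr (\<alpha> / 2)) \<partial>\<mu>) = (\<integral>\<^sup>+z. ennreal (Y z powr (\<alpha> / 2)) \<partial>(gauss_vec \<Otimes>\<^sub>M \<nu>))"
        using laplace p \<alpha>
        by (intro moment_eq_of_laplace_eq[OF \<mu>.prob_space_axioms X Q.prob_space_axioms Y]) auto
      also have "\<dots> = ennreal (2 powr (\<alpha> / 2) * Gamma ((\<alpha> + d) / 2) / Gamma (d / 2)) * (\<integral>\<^sup>+t. ennreal (rpow t (\<alpha> / p)) \<partial>\<nu>)"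
        using Y_moment[OF \<alpha>] by (simp add: p)
      finally have "(\<integral>\<^sup>+v. ennreal (rpow (norm v) \<alpha>) \<partial>\<mu>)
          = ennreal (2 powr (\<alpha> / 2) * (2 powr (\<alpha> / 2) * Gamma ((\<alpha> + d) / 2) / Gamma (d / 2)))
            * (\<integral>\<^sup>+t. ennreal (rpow t (\<alpha> / p)) \<partial>\<nu>)"
        using G by (simp add: X_moment[OF \<alpha>] mult.assoc[symmetric] ennreal_mult[symmetric])
      also have "2 powr (\<alpha> / 2) * (2 powr (\<alpha> / 2) * Gamma ((\<alpha> + d) / 2) / Gamma (d / 2))
          = (2 powr (\<alpha> / 2) * 2 powr (\<alpha> / 2)) * Gamma ((\<alpha> + d) / 2) / Gamma (d / 2)"
        by (simp add: mult_ac)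
      also have "2 powr (\<alpha> / 2) * 2 powr (\<alpha> / 2) = (2 powr \<alpha> :: real)"
        by (simp flip: powr_add)
      finally show ?thesis .
    qed
  qed
qed

end
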